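(* Let $d,p\ge 1$ be integers, let $D=\binom{d+p-1}{p}$, and let $\mathcal V\subset\mathbb R^d$ be a projective variety whose $p$-th order tensorized subspace $\mathcal S\subset\mathbb R^D$ has dimension $R$. Suppose there exists a tensorized observation pattern $\upsilon=\omega^{\otimes p}$, with $\omega\in\{0,1\}^d$, such that $|\upsilon|>R$ and $\dim \mathcal S_\upsilon=R$. Then for every integer $m$ with $|\omega|+p\le m\le d$, the subspace $\mathcal S$ is uniquely identifiable from its canonical projections onto all possible tensorized observation patterns of size $m$.
   Context: Tensorization: for $x\in\mathbb R^d$, $x^{\otimes p}\in\mathbb R^D$ with $D=\binom{d+p-1}{p}$ denotes the vector whose coordinates are indexed by tuples $1\le k_1\le\cdots\le k_p\le d$, the coordinate $(k_1,\dots,k_p)$ being $x_{k_1}\cdots x_{k_p}$ (the distinct entries of the $p$-fold Kronecker product of $x$ with itself). A (real) projective variety $\mathcal V\subset\mathbb R^d$ is the common zero set in $\mathbb R^d$ of finitely many homogeneous polynomials $q_1,\dots,q_n$ (possibly of different degrees). Its $p$-th order tensorized subspace is $\mathcal S=\operatorname{span}\{x^{\otimes p}:x\in\mathcal V\}\subset\mathbb R^D$. Observation patterns: for a binary vector $\omega$, $|\omega|$ is its number of ones. For $\omega\in\{0,1\}^d$, the vector $\omega^{\otimes p}\in\{0,1\}^D$ is called a tensorized observation pattern; it has size $m$ if $|\omega|=m$ (in which case $|\omega^{\otimes p}|=\binom{m+p-1}{p}$). Canonical projections: for $\upsilon\in\{0,1\}^D$ and $y\in\mathbb R^D$, $y_\upsilon\in\mathbb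 R^{|\upsilon|}$ is the restriction of $y$ to the coordinates where $\upsilon$ equals one; $\mathcal S_\upsilon=\{y_\upsilon:y\in\mathcal S\}$ is the canonical projection of $\mathcal S$ onto $\upsilon$. A subspace $\mathcal S\subset\mathbb R^D$ is uniquely identifiable from its canonical projections onto patterns $\upsilon_1,\dots,\upsilon_n$ if the only subspace $\mathcal S'\subset\mathbb R^D$ with $\mathcal S'_{\upsilon_i}=\mathcal S_{\upsilon_i}$ for all $i$ is $\mathcal S'=\mathcal S$. *)

theory Defs
  imports "HOL-Analysis.Analysis" "HOL-Library.Poly_Mapping" "HOL-Library.Multiset"
begin

text \<open>
  The dimension \<open>d\<close> and the tensor order \<open>p\<close> are \<open>CARD('d)\<close> and \<open>CARD('p)\<close>. The tuples
  \<open>k\<^sub>1 \<le> \<dots> \<le> k\<^sub>p\<close> of indices form a finite type, so that \<open>\<real>\<^sup>D\<close> is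
  \<open>real ^ ('d, 'p) mtuple\<close>.
\<close>

typedef (overloaded) ('d::linorder, 'p) mtuple = "{ks :: 'd list. sorted ks \<and> length ks = CARD('p)}"
  morphisms list_of_mtuple Abs_mtuple
proof
  show "replicate CARD('p) undefined \<in> {ks :: 'd list. sorted ks \<and> length ks = CARD('p)}"
    by simp
qed

lemma bij_betw_mtuple_multisets:
  "bij_betw (\<lambda>k :: ('d::linorder, 'p) mtuple. mset (list_of_mtuple k)) UNIV
     (multisets_of_size UNIV CARD('p))"
proof (rule bij_betwI')
  fix k l :: "('d, 'p) mtuple"
  show "(mset (list_of_mtuple k) = mset (list_of_mtuple l)) = (k = l)"
    using list_of_mtuple[of k] list_of_mtuple[of l]
    by (metis (mono_tags, lifting) list_of_mtuple_inject mem_Collect_eq properties_for_sort)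
next
  fix k :: "('d, 'p) mtuple"
  show "mset (list_of_mtuple k) \<in> multisets_of_size UNIV CARD('p)"
    using list_of_mtuple[of k] by (simp add: multisets_of_size_def)
next
  fix M :: "'d multiset"
  assume M: "M \<in> multisets_of_size UNIV CARD('p)"
  then have "list_of_mtuple (Abs_mtuple (sorted_list_of_multiset M) :: ('d, 'p) mtuple) =
      sorted_list_of_multiset M"
    by (intro Abs_mtuple_inverse)
      (simp add: multisets_of_size_def flip: size_mset)
  then show "\<exists>k\<in>UNIV. M = mset (list_of_mtuple (k :: ('d, 'p) mtuple))"
    by (metis UNIV_I mset_sorted_list_of_multiset)
qed

instance mtuple :: ("{finite, linorder}", type) finite
proof
  have "finite {ks :: 'a list. set ks \<subseteq> UNIV \<and> length ks = CARD('b)}"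
    by (rule finite_lists_length_eq) simp
  then have "finite (range (list_of_mtuple :: ('a, 'b) mtuple \<Rightarrow> _))"
    by (rule finite_subset[rotated]) (use list_of_mtuple in auto)
  then show "finite (UNIV :: ('a, 'b) mtuple set)"
    by (rule finite_imageD) (simp add: inj_def list_of_mtuple_inject)
qed

lemma card_mtuple:
  "CARD(('d::{finite,linorder}, 'p) mtuple) = (CARD('d) + CARD('p) - 1) choose CARD('p)"
  using bij_betw_same_card[OF bij_betw_mtuple_multisets[where 'd = 'd and 'p = 'p]]
  by (simp add: card_multisets_of_size)

definition tensor_power :: "real ^ 'd::{finite,linorder} \<Rightarrow> real ^ ('d, 'p) mtuple"
  where "tensor_power x = (\<chi> k. \<Prod>i\<leftarrow>list_of_mtuple k. x $ i)"


text \<open>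
  A polynomial in indeterminates indexed by \<open>'d\<close> is a finitely supported map from exponent
  vectors to coefficients.
\<close>

type_synonym 'd rpoly = "('d \<Rightarrow>\<^sub>0 nat) \<Rightarrow>\<^sub>0 real"

definition poly_eval :: "'d::finite rpoly \<Rightarrow> real ^ 'd \<Rightarrow> real"
  where "poly_eval q x =
    (\<Sum>\<alpha>\<in>Poly_Mapping.keys q. Poly_Mapping.lookup q \<alpha> * (\<Prod>i\<in>UNIV. (x $ i) ^ Poly_Mapping.lookup \<alpha> i))"

definition homogeneous_poly :: "'d::finite rpoly \<Rightarrow> bool"
  where "homogeneous_poly q \<longleftrightarrow>
    (\<exists>n. \<forall>\<alpha>\<in>Poly_Mapping.keys q. (\<Sum>i\<in>UNIV. Poly_Mapping.lookup \<alpha> i) = n)"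

definition projective_variety :: "(real ^ 'd::finite) set \<Rightarrow> bool"
  where "projective_variety V \<longleftrightarrow>
    (\<exists>Q. finite Q \<and> (\<forall>q\<in>Q. homogeneous_poly q) \<and> V = {x. \<forall>q\<in>Q. poly_eval q x = 0})"

definition tensorized_subspace ::
  "(real ^ 'd::{finite,linorder}) set \<Rightarrow> (real ^ ('d, 'p) mtuple) set"
  where "tensorized_subspace V = span (tensor_power ` V)"


definition binary_vec :: "real ^ 'n::finite \<Rightarrow> bool"
  where "binary_vec v \<longleftrightarrow> (\<forall>i. v $ i \<in> {0, 1})"

definition num_ones :: "real ^ 'n::finite \<Rightarrow> nat"
  where "num_ones v = card {i. v $ i = 1}"

definition tensorized_patterns :: "nat \<Rightarrow> (real ^ ('d::{finite,linorder}, 'p) mtuple) set"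
  where "tensorized_patterns m =
    {tensor_power \<omega> | \<omega>. binary_vec \<omega> \<and> num_ones \<omega> = m}"

text \<open>
  The target \<open>\<real>\<^bsup>|v|\<^esup>\<close> of the restriction to \<open>v\<close> is realised as the coordinate subspace of
  the vectors that vanish wherever \<open>v\<close> is not one.
\<close>

definition canonical_proj :: "real ^ 'n::finite \<Rightarrow> real ^ 'n \<Rightarrow> real ^ 'n"
  where "canonical_proj v y = (\<chi> i. if v $ i = 1 then y $ i else 0)"

definition uniquely_identifiable :: "(real ^ 'n::finite) set \<Rightarrow> (real ^ 'n) set \<Rightarrow> bool"
  where "uniquely_identifiable S P \<longleftrightarrow>
    (\<forall>S'. subspace S' \<and> (\<forall>v\<in>P. canonical_proj v ` S' = canonical_proj v ` S) \<longrightarrow> S' = S)"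

end

(* Since the projection onto \<upsilon> preserves the dimension of S, it is injective on S. Every
   coordinate k lies together with \<upsilon> in a tensorized pattern of size m, because adjoining
   the at most p indices in k to \<omega> gives at most |\<omega>| + p ones. So if S' has the same
   projections as S, then for y in S' and every k some z in S agrees with y on \<upsilon> and at k;
   by injectivity z does not depend on k, whence y = z. *)
theory Submission
  imports Defs
begin

lemma inj_on_subspace_if_dim_image_eq:
  fixes f :: "'a::euclidean_space \<Rightarrow> 'b::euclidean_space"
  assumes "linear f" "subspace S" "dim (f ` S) = dim S"
  shows "inj_on f S"
proof -
  obtain B where B: "B \<subseteq> S" "independent B" "S \<subseteq> span B" "card B = dim S"
    by (rule basis_exists)
  have fin: "finite B"
    using B(2) by (rule finiteI_independent)
  have spanB: "span B = S"
    using B(1,3) assms(2) by (simp add: span_minimal subset_antisym)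
  have fS: "f ` S = span (f ` B)"
    using linear_span_image[OF assms(1)] spanB by metis
  have "dim (f ` S) \<le> card (f ` B)"
    unfolding fS dim_span using fin by (intro dim_le_card') simp
  \<comment> \<open>Squeeze: \<open>card B = dim S = dim (f\<close> S) \<le> card (f
    \<open>B) \<le> card B\<close>.\<close>
  then have card: "card (f ` B) = card B"
    using card_image_le[OF fin, of f] B(4) assms(3) by linarith
  have "independent (f ` B)"
    by (rule card_le_dim_spanning[where V = "f ` S"])
      (use B(1,4) fin card assms(3) fS in auto)
  moreover have "inj_on f B"
    using card fin by (rule eq_card_imp_inj_on[rotated])
  ultimately show ?thesis
    using linear_inj_on_span_iff_independent_image[OF assms(1)] spanB by metis
qed

lemma linear_canonical_proj: "linear (canonical_proj v)"
  by (rule linearI) (auto simp: canonical_proj_def vec_eq_iff)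

lemma canonical_proj_eq_iff:
  "canonical_proj v y = canonical_proj v z \<longleftrightarrow> (\<forall>i. v $ i = 1 \<longrightarrow> y $ i = z $ i)"
  by (auto simp: canonical_proj_def vec_eq_iff)

text \<open>A product of zeros and ones is 1 only if every factor is. Containment between tensorized
  patterns thus reduces to containment between index sets in the base space.\<close>

lemma tensor_power_eq_1_iff:
  assumes "binary_vec \<omega>"
  shows "tensor_power \<omega> $ k = 1 \<longleftrightarrow> (\<forall>i\<in>set (list_of_mtuple k). \<omega> $ i = 1)"
proof -
  have "prod_list (map (($) \<omega>) ks) \<in> {0, 1} \<and>
      (prod_list (map (($) \<omega>) ks) = 1 \<longleftrightarrow> (\<forall>i\<in>set ks. \<omega> $ i = 1))" for ks
    using assms by (induction ks) (auto simp: binary_vec_def)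
  then show ?thesis
    by (simp add: tensor_power_def)
qed

lemma obtain_tensorized_pattern_covering:
  fixes \<omega> :: "real ^ 'd::{finite,linorder}" and k :: "('d, 'p) mtuple"
  assumes "binary_vec \<omega>" "num_ones \<omega> + CARD('p) \<le> m" "m \<le> CARD('d)"
  obtains v :: "real ^ ('d, 'p) mtuple" where "v \<in> tensorized_patterns m" "v $ k = 1"
    "\<And>l. tensor_power \<omega> $ l = 1 \<Longrightarrow> v $ l = 1"
proof -
  define A where "A = {i. \<omega> $ i = 1} \<union> set (list_of_mtuple k)"
  have "length (list_of_mtuple k) = CARD('p)"
    using list_of_mtuple[of k] by simp
  then have "card (set (list_of_mtuple k)) \<le> CARD('p)"
    using card_length by metis
  then have "card A \<le> m"
    using card_Un_le[of "{i. \<omega> $ i = 1}" "set (list_of_mtuple k)"] assms(2)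
    unfolding A_def num_ones_def by linarith
  \<comment> \<open>\<open>A\<close> may be too small, for instance when \<open>k\<close> repeats
    indices or meets \<omega>; padding it to exactly \<open>m\<close> indices keeps everything
    covered.\<close>
  then obtain B where B: "A \<subseteq> B" "card B = m"
    using exists_subset_between[of A m UNIV] assms(3) by auto
  define \<omega>' :: "real ^ 'd::{finite,linorder}" where "\<omega>' = (\<chi> i. if i \<in> B then 1 else 0)"
  have bin: "binary_vec \<omega>'" and one: "\<omega>' $ i = 1 \<longleftrightarrow> i \<in> B" for i
    by (auto simp: \<omega>'_def binary_vec_def)
  show thesis
  proof
    show "tensor_power \<omega>' \<in> (tensorized_patterns m :: (real ^ ('d, 'p) mtuple) set)"
      using bin one B(2) by (auto simp: tensorized_patterns_def num_ones_def)
    show "tensor_power \<omega>' $ k = 1"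
      using B(1) by (auto simp: tensor_power_eq_1_iff[OF bin] one A_def)
    show "tensor_power \<omega>' $ l = 1" if "tensor_power \<omega> $ l = 1" for l :: "('d, 'p) mtuple"
      using that B(1)
      by (auto simp: tensor_power_eq_1_iff[OF bin] tensor_power_eq_1_iff[OF assms(1)] one A_def)
  qed
qed

text \<open>Separates the identification argument from tensors: only injectivity on \<open>u\<close>
  and the covering of \<open>u\<close> plus one further coordinate matter.\<close>

lemma uniquely_identifiable_if_inj_on_proj:
  assumes inj: "inj_on (canonical_proj u) S"
    and cover: "\<And>k. \<exists>v\<in>P. v $ k = 1 \<and> (\<forall>l. u $ l = 1 \<longrightarrow> v $ l = 1)"
  shows "uniquely_identifiable S P"
  unfolding uniquely_identifiable_def
proof (intro allI impI, elim conjE)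
  fix S' assume eq: "\<forall>v\<in>P. canonical_proj v ` S' = canonical_proj v ` S"
  \<comment> \<open>Stated for arbitrary \<open>X\<close> and \<open>Y\<close> because it serves
    both inclusions, with the roles of \<open>S\<close> and \<open>S'\<close> exchanged.\<close>
  have agree: "\<exists>z\<in>Y. canonical_proj u z = canonical_proj u y \<and> z $ k = y $ k"
    if y: "y \<in> X" and XY: "\<And>v. v \<in> P \<Longrightarrow> canonical_proj v ` X = canonical_proj v ` Y" for X Y y k
  proof -
    obtain v where v: "v \<in> P" "v $ k = 1" "\<And>l. u $ l = 1 \<Longrightarrow> v $ l = 1"
      using cover by blast
    obtain z where "z \<in> Y" "canonical_proj v y = canonical_proj v z"
      using XY[OF v(1)] y by blast
    then show ?thesis
      using v(2,3) by (auto simp: canonical_proj_eq_iff intro!: bexI[of _ z])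
  qed
  have sub: "S' \<subseteq> S"
  proof
    fix y assume y: "y \<in> S'"
    have ex: "\<exists>z\<in>S. canonical_proj u z = canonical_proj u y \<and> z $ k = y $ k" for k
      by (rule agree[OF y]) (use eq in simp)
    then obtain z where z: "z \<in> S" "canonical_proj u z = canonical_proj u y"
      by blast
    have "z $ k = y $ k" for k
      using ex[of k] z inj by (metis inj_onD)
    then show "y \<in> S"
      using z(1) by (metis vec_eq_iff)
  qed
  moreover have "S \<subseteq> S'"
  proof
    fix y assume y: "y \<in> S"
    \<comment> \<open>Any coordinate will do here, hence \<open>undefined\<close>: by
      \<open>sub\<close> the witness already lies in \<open>S\<close>, so injectivity on
      \<open>u\<close> alone forces it to be \<open>y\<close>.\<close>
    obtain z where "z \<in> S'" "canonical_proj u z = canonical_proj u y"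
      using agree[OF y, of S' undefined] eq by auto
    then show "y \<in> S'"
      using sub y inj by (metis inj_onD subsetD)
  qed
  ultimately show "S' = S" ..
qed

theorem theorem1:
  fixes V :: "(real ^ 'd::{finite,linorder}) set"
    and S :: "(real ^ ('d, 'p::finite) mtuple) set"
    and \<omega> :: "real ^ 'd::{finite,linorder}"
    and \<upsilon> :: "real ^ ('d, 'p) mtuple"
    and R m :: nat
  assumes "projective_variety V"
    and "S = tensorized_subspace V"
    and "dim S = R"
    and "binary_vec \<omega>"
    and "\<upsilon> = tensor_power \<omega>"
    and "num_ones \<upsilon> > R"
    and "dim (canonical_proj \<upsilon> ` S) = R"
    and "num_ones \<omega> + CARD('p) \<le> m"
    and "m \<le> CARD('d)"
  shows "uniquely_identifiable S (tensorized_patterns m)"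
proof (rule uniquely_identifiable_if_inj_on_proj)
  show "inj_on (canonical_proj \<upsilon>) S"
    using assms(2,3,7)
    by (intro inj_on_subspace_if_dim_image_eq linear_canonical_proj)
      (simp_all add: tensorized_subspace_def)
next
  fix k :: "('d, 'p) mtuple"
  show "\<exists>v\<in>tensorized_patterns m. v $ k = 1 \<and> (\<forall>l. \<upsilon> $ l = 1 \<longrightarrow> v $ l = 1)"
    using obtain_tensorized_pattern_covering[OF assms(4,8,9), of k] assms(5) by metis
qed

end
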